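(* There is an absolute constant $C>0$, and for every $\delta>0$ and every $\lambda\in(0,\infty)$ there is a positive constant $C_{\delta,\lambda}$ depending only on $\delta$ and $\lambda$, such that for every scalar function $F:\mathbb{R}^2\to\mathbb{R}$ with $F\in W^{1,2+\delta}(\mathbb{R}^2)$ and every radius $R\in(0,\infty)$, $$\|F\|_{L^\infty(\mathbb{R}^2)}\le C_{\delta,\lambda}\max\left\{1,\ \sup_{q\ge2}\frac{\|F\|_{L^q(\mathbb{R}^2)}}{q^\lambda R^{2/q}}\right\}\log^\lambda\left(e^2+C\,R^{\delta/(2+\delta)}\left(\frac{\|F\|_{L^{2+\delta}(\mathbb{R}^2)}}{R}+\|\nabla F\|_{L^{2+\delta}(\mathbb{R}^2)}\right)\right).$$
   Context: $\log^\lambda(\cdot)$ means $(\log(\cdot))^\lambda$. The supremum is over real $q\ge 2$ and may be $+\infty$, in which case the inequality is trivial. *)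

theory Defs
  imports "HOL-Analysis.Analysis" "HOL-Probability.Essential_Supremum"
begin

text \<open>
  The \<open>L\<^sup>p\<close> norms take values in \<^typ>\<open>ennreal\<close>, so that a norm which is not finite is
  \<open>\<infinity>\<close> rather than a junk real value. They are meant for Lebesgue measurable functions and
  \<open>p \<ge> 1\<close>. The case distinction only spells out \<open>\<infinity> powr (1 / p) = \<infinity>\<close>, as there is no
  real power on \<^typ>\<open>ennreal\<close> in the library.
\<close>

definition Lp_norm :: "real \<Rightarrow> ('a::euclidean_space \<Rightarrow> 'b::real_normed_vector) \<Rightarrow> ennreal" where
  "Lp_norm p f =
     (let I = (\<integral>\<^sup>+x. ennreal (norm (f x) powr p) \<partial>lebesgue)
      in if I = \<infinity> then \<infinity> else ennreal (enn2real I powr (1 / p)))"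

definition Linf_norm :: "('a::euclidean_space \<Rightarrow> 'b::real_normed_vector) \<Rightarrow> ennreal" where
  "Linf_norm f = esssup lebesgue (\<lambda>x. ennreal (norm (f x)))"

definition Lp_space :: "real \<Rightarrow> ('a::euclidean_space \<Rightarrow> 'b::real_normed_vector) set" where
  "Lp_space p = {f. f \<in> borel_measurable lebesgue \<and> Lp_norm p f < \<infinity>}"

primrec Ck :: "nat \<Rightarrow> ('a::euclidean_space \<Rightarrow> real) \<Rightarrow> bool" where
  "Ck 0 f \<longleftrightarrow> continuous_on UNIV f"
| "Ck (Suc k) f \<longleftrightarrow> f differentiable_on UNIV \<and> (\<forall>v. Ck k (\<lambda>x. frechet_derivative f (at x) v))"

definition test_function :: "('a::euclidean_space \<Rightarrow> real) \<Rightarrow> bool" where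
  "test_function \<phi> \<longleftrightarrow> (\<forall>k. Ck k \<phi>) \<and> compact (closure {x. \<phi> x \<noteq> 0})"

definition locally_integrable :: "('a::euclidean_space \<Rightarrow> 'b::euclidean_space) \<Rightarrow> bool" where
  "locally_integrable f \<longleftrightarrow> (\<forall>K. compact K \<longrightarrow> f absolutely_integrable_on K)"

definition has_weak_gradient :: "('a::euclidean_space \<Rightarrow> real) \<Rightarrow> ('a \<Rightarrow> 'a) \<Rightarrow> bool" where
  "has_weak_gradient F G \<longleftrightarrow>
     locally_integrable F \<and> locally_integrable G \<and>
     (\<forall>\<phi>. test_function \<phi> \<longrightarrow> (\<forall>b\<in>Basis.
        (LINT x|lebesgue. F x * frechet_derivative \<phi> (at x) b) =
        - (LINT x|lebesgue. (G x \<bullet> b) * \<phi> x)))"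

text \<open>
  A weak gradient is unique up to null sets, so the choice of a representative affects neither
  membership in \<^const>\<open>Lp_space\<close> nor the value of \<^const>\<open>Lp_norm\<close>.
\<close>

definition weak_gradient :: "('a::euclidean_space \<Rightarrow> real) \<Rightarrow> 'a \<Rightarrow> 'a" where
  "weak_gradient F = (SOME G. has_weak_gradient F G)"

definition Sobolev_W1 :: "real \<Rightarrow> ('a::euclidean_space \<Rightarrow> real) set" where
  "Sobolev_W1 p =
     {F. F \<in> Lp_space p \<and> (\<exists>G. has_weak_gradient F G) \<and> weak_gradient F \<in> Lp_space p}"

end

theory Submission
  imports Defs
begin

text \<open>
  The inequality comes from balancing two estimates of \<open>F\<close> at a scale \<open>r\<close>. Write \<open>p = 2 + \<delta>\<close>,
  \<open>\<alpha> = 1 - 2 / p = \<delta> / (2 + \<delta>)\<close> and \<open>G\<close> for the weak gradient. The mean of \<open>F\<close> over a square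
  of side \<open>r\<close> is at most a constant times \<open>r powr (- 2 / q)\<close> times the norm of \<open>F\<close> in \<open>L\<^sup>q\<close>, for every
  \<open>q\<close>, while by Morrey's argument \<open>F\<close> differs from that mean by at most a constant times
  \<open>r powr \<alpha>\<close> times the norm of \<open>G\<close> in \<open>L\<^sup>p\<close>. Together this is \<open>AE_abs_le_Lp_norm_and_gradient\<close>.

  Let \<open>M\<close> be the maximum in the theorem and \<open>A\<close> be \<open>1 + R powr \<alpha>\<close> times the norm of \<open>G\<close>. The choice
  \<open>r = R * A powr (- 1 / \<alpha>)\<close> makes the second estimate a constant. The first one becomes
  \<open>M * q powr \<lambda> * A powr (2 / (\<alpha> * q))\<close>, and taking \<open>q\<close> to be twice the logarithm
  \<open>L\<close> of the theorem, which is at least \<open>ln A\<close>, turns this into a constant times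
  \<open>M * L powr \<lambda>\<close>. One may take \<open>C = 1\<close>.

  Morrey's estimate is proved directly from the definition of the weak gradient. The means are
  taken with a smooth product kernel. The difference of two such kernels at the scales
  \<open>r\<close> and \<open>2 * r\<close> is the divergence of an explicit compactly supported field, since the
  one-dimensional kernel is by construction the derivative of a smooth step
  (\<open>mollified_diff_eq\<close>). Summing over dyadic scales bounds all mollifications at small
  scales, uniformly in the point, and such a bound passes to \<open>F\<close> almost everywhere
  (\<open>AE_abs_le_if_mollified_le\<close>).
\<close>

section \<open>Calculus of smooth functions\<close>

lemma Ck_SucI:
  assumes "\<And>x. (f has_derivative f' x) (at x)" and "\<And>v. Ck k (\<lambda>x. f' x v)"
  shows "Ck (Suc k) f"
proof -
  have "frechet_derivative f (at x) = f' x" for x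
    using assms(1) frechet_derivative_at by metis
  then show ?thesis
    using assms by (auto simp: differentiable_on_def differentiable_def)
qed

lemma Ck_Suc_has_derivative:
  assumes "Ck (Suc k) f"
  shows "(f has_derivative frechet_derivative f (at x)) (at x)"
  using assms by (auto simp: differentiable_on_def frechet_derivative_works)

lemma Ck_Suc_derivative: "Ck (Suc k) f \<Longrightarrow> Ck k (\<lambda>x. frechet_derivative f (at x) v)"
  by simp

lemma Ck_Suc_has_real_derivative:
  fixes f :: "real \<Rightarrow> real"
  assumes "Ck (Suc k) f"
  shows "(f has_real_derivative frechet_derivative f (at t) 1) (at t)"
proof -
  have d: "(f has_derivative frechet_derivative f (at t)) (at t)"
    using assms by (rule Ck_Suc_has_derivative)
  have "frechet_derivative f (at t) s = frechet_derivative f (at t) 1 * s" for s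
    using linear_scale[OF has_derivative_linear[OF d], of s 1] by simp
  then have "frechet_derivative f (at t) = (*) (frechet_derivative f (at t) 1)"
    by (rule ext)
  then show ?thesis
    using d by (simp add: has_field_derivative_def)
qed

lemma Ck_SucD: "Ck (Suc k) f \<Longrightarrow> Ck k f"
proof (induction k arbitrary: f)
  case 0
  then show ?case by (auto intro: differentiable_imp_continuous_on)
next
  case (Suc k)
  then show ?case by (metis Ck.simps(2))
qed

lemma Ck_const: "Ck k (\<lambda>x. c)"
proof (induction k arbitrary: c)
  case (Suc k)
  show ?case
    by (rule Ck_SucI[where f' = "\<lambda>x v. 0"]) (use Suc in auto)
qed simp

lemma Ck_add: "Ck k f \<Longrightarrow> Ck k g \<Longrightarrow> Ck k (\<lambda>x. f x + g x)"
proof (induction k arbitrary: f g)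
  case 0
  then show ?case by (auto intro: continuous_intros)
next
  case (Suc k)
  show ?case
    by (rule Ck_SucI, rule has_derivative_add[OF Ck_Suc_has_derivative Ck_Suc_has_derivative])
       (use Suc in auto)
qed

lemma Ck_mult: "Ck k f \<Longrightarrow> Ck k g \<Longrightarrow> Ck k (\<lambda>x. f x * g x)"
proof (induction k arbitrary: f g)
  case 0
  then show ?case by (auto intro: continuous_intros)
next
  case (Suc k)
  show ?case
  proof (rule Ck_SucI, rule has_derivative_mult[OF Ck_Suc_has_derivative Ck_Suc_has_derivative])
    fix v
    show "Ck k (\<lambda>x. f x * frechet_derivative g (at x) v + frechet_derivative f (at x) v * g x)"
      using Suc.prems by (intro Ck_add Suc.IH Ck_SucD[of k f] Ck_SucD[of k g] Ck_Suc_derivative)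
  qed (use Suc.prems in auto)
qed

text \<open>
  The derivative of a reciprocal is again built from the reciprocal and from lower derivatives,
  so the induction hypothesis applies to it.
\<close>
lemma Ck_inverse: "Ck k f \<Longrightarrow> (\<And>x. f x \<noteq> 0) \<Longrightarrow> Ck k (\<lambda>x. inverse (f x))"
proof (induction k arbitrary: f)
  case 0
  then show ?case by (auto intro: continuous_intros)
next
  case (Suc k)
  show ?case
  proof (rule Ck_SucI)
    show "((\<lambda>x. inverse (f x)) has_derivative
        (\<lambda>v. - 1 * (inverse (f x) * frechet_derivative f (at x) v * inverse (f x)))) (at x)" for x
      using Deriv.has_derivative_inverse[OF Suc.prems(2) Ck_Suc_has_derivative[OF Suc.prems(1)]] by simp
    show "Ck k (\<lambda>x. - 1 * (inverse (f x) * frechet_derivative f (at x) v * inverse (f x)))" for v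
      using Suc.prems by (intro Ck_mult Ck_const Suc.IH Ck_SucD[of k f] Ck_Suc_derivative) auto
  qed
qed

text \<open>
  Differentiating \<open>f (A x + d)\<close> in direction \<open>v\<close> gives the same affine map composed with the
  derivative of \<open>f\<close> in the fixed direction \<open>A v\<close>, so no product rule is involved.
\<close>
lemma Ck_compose_affine:
  assumes "bounded_linear A" and "Ck k f"
  shows "Ck k (\<lambda>x. f (A x + d))"
  using assms(2)
proof (induction k arbitrary: f)
  case 0
  then show ?case
    using assms(1)
    by (auto intro!: continuous_intros bounded_linear.continuous_on[OF assms(1)]
             intro: continuous_on_compose2)
next
  case (Suc k)
  show ?case
  proof (rule Ck_SucI)
    show "((\<lambda>x. f (A x + d)) has_derivative
        (\<lambda>v. frechet_derivative f (at (A x + d)) (A v))) (at x)" for x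
      by (rule has_derivative_compose[OF _ Ck_Suc_has_derivative[OF Suc.prems]])
         (auto intro!: derivative_eq_intros bounded_linear.has_derivative[OF assms(1)])
    show "Ck k (\<lambda>x. frechet_derivative f (at (A x + d)) (A v))" for v
      by (rule Suc.IH) (use Suc.prems in auto)
  qed
qed

section \<open>A smooth step and its derivative\<close>

text \<open>
  The polynomial factor in \<open>1 / t\<close> makes this family closed under differentiation; the member
  for the constant polynomial \<open>1\<close> is Cauchy's flat function.
\<close>
definition flat :: "real poly \<Rightarrow> real \<Rightarrow> real" where
  "flat p t = (if t > 0 then poly p (1 / t) * exp (- 1 / t) else 0)"

lemma poly_times_exp_minus_tendsto_0: "((\<lambda>u::real. poly p u * exp (- u)) \<longlongrightarrow> 0) at_top"
proof -
  have "((\<lambda>u::real. \<Sum>i\<le>degree p. coeff p i * (u ^ i / exp u)) \<longlongrightarrow> 0) at_top"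
    by (intro tendsto_null_sum tendsto_mult_right_zero tendsto_power_div_exp_0)
  then show ?thesis
    by (simp add: poly_altdef sum_divide_distrib exp_minus field_simps)
qed

text \<open>
  Away from the origin this is the product rule. At the origin the difference quotient from the
  right is \<open>u * poly p u * exp (- u)\<close> with \<open>u = 1 / h\<close> tending to infinity.
\<close>
lemma flat_has_real_derivative:
  "(flat p has_real_derivative flat (monom 1 2 * (p - pderiv p)) t) (at t)"
proof (cases "t = 0")
  case False
  then consider "t > 0" | "t < 0" by linarith
  then show ?thesis
  proof cases
    case 1
    have "((\<lambda>t. poly p (1 / t) * exp (- 1 / t)) has_real_derivative
            flat (monom 1 2 * (p - pderiv p)) t) (at t)"
      using 1
      by (auto intro!: derivative_eq_intros simp: flat_def poly_monom power2_eq_square field_simps)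
    then show ?thesis
      by (rule has_field_derivative_transform_within_open[of _ _ _ "{0<..}"])
         (use 1 in \<open>auto simp: flat_def\<close>)
  next
    case 2
    have "((\<lambda>t. 0) has_real_derivative flat (monom 1 2 * (p - pderiv p)) t) (at t)"
      using 2 by (auto simp: flat_def)
    then show ?thesis
      by (rule has_field_derivative_transform_within_open[of _ _ _ "{..<0}"])
         (use 2 in \<open>auto simp: flat_def\<close>)
  qed
next
  case True
  have "((\<lambda>h. poly (pCons 0 p) (inverse h) * exp (- inverse h)) \<longlongrightarrow> 0) (at_right 0)"
    by (rule filterlim_compose[OF poly_times_exp_minus_tendsto_0 filterlim_inverse_at_top_right])
  then have "((\<lambda>h. flat p h / h) \<longlongrightarrow> 0) (at_right 0)"
    by (rule Lim_transform_eventually)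
       (auto simp: flat_def eventually_at_filter field_simps)
  moreover have "((\<lambda>h. flat p h / h) \<longlongrightarrow> 0) (at_left 0)"
    by (rule Lim_transform_eventually[OF tendsto_const])
       (auto simp: flat_def eventually_at_filter)
  ultimately have "((\<lambda>h. flat p h / h) \<longlongrightarrow> 0) (at 0)"
    by (simp add: filterlim_split_at)
  then show ?thesis
    using True by (simp add: DERIV_def flat_def)
qed

lemma Ck_flat: "Ck k (flat p)"
proof (induction k arbitrary: p)
  case 0
  show ?case
    by (auto simp: continuous_on_eq_continuous_at intro: DERIV_isCont flat_has_real_derivative)
next
  case (Suc k)
  show ?case
  proof (rule Ck_SucI)
    show "(flat p has_derivative (*) (flat (monom 1 2 * (p - pderiv p)) x)) (at x)" for x
      using flat_has_real_derivative by (simp add: has_field_derivative_def)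
    show "Ck k (\<lambda>x. flat (monom 1 2 * (p - pderiv p)) x * v)" for v
      by (intro Ck_mult Ck_const Suc.IH)
  qed
qed

text \<open>
  Everything below rests on a kernel whose one-dimensional primitive is explicit. Therefore the
  step comes first and the bump is defined as its derivative: differences of rescaled bumps then
  have compactly supported primitives given by a formula.
\<close>
definition smooth_step :: "real \<Rightarrow> real" where
  "smooth_step t = flat 1 t * inverse (flat 1 t + flat 1 (1 - t))"

definition bump :: "real \<Rightarrow> real" where
  "bump t = frechet_derivative smooth_step (at t) 1"

lemma flat_1_sum_pos: "0 < flat 1 t + flat 1 (1 - t)"
  by (cases "t > 0"; cases "t < 1") (auto simp: flat_def intro: add_pos_pos)

lemma Ck_smooth_step: "Ck k smooth_step"
proof -
  have "Ck k (\<lambda>t. flat 1 (- t + 1))"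
    by (rule Ck_compose_affine[OF bounded_linear_minus[OF bounded_linear_ident] Ck_flat])
  then show ?thesis
    unfolding smooth_step_def[abs_def] using flat_1_sum_pos
    by (intro Ck_mult Ck_inverse Ck_add Ck_flat) (auto simp: less_imp_neq[symmetric])
qed

lemma Ck_bump: "Ck k bump"
  unfolding bump_def[abs_def] using Ck_smooth_step by (rule Ck_Suc_derivative)

lemma smooth_step_has_real_derivative: "(smooth_step has_real_derivative bump t) (at t)"
  unfolding bump_def using Ck_smooth_step by (rule Ck_Suc_has_real_derivative)

lemma smooth_step_eq_0: "t \<le> 0 \<Longrightarrow> smooth_step t = 0"
  by (simp add: smooth_step_def flat_def)

lemma smooth_step_eq_1: "1 \<le> t \<Longrightarrow> smooth_step t = 1"
  by (simp add: smooth_step_def flat_def)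

lemma smooth_step_bounds: "0 \<le> smooth_step t" "smooth_step t \<le> 1"
proof -
  have "0 \<le> flat 1 t" "0 \<le> flat 1 (1 - t)" by (auto simp: flat_def)
  with flat_1_sum_pos[of t] show "0 \<le> smooth_step t" "smooth_step t \<le> 1"
    by (auto simp: smooth_step_def field_simps)
qed

lemma continuous_on_bump: "continuous_on S bump"
  using Ck_bump[of 0] continuous_on_subset by auto

lemma bump_eq_0:
  assumes "t \<notin> {0..1}"
  shows "bump t = 0"
proof -
  consider "t < 0" | "t > 1" using assms by force
  then show ?thesis
  proof cases
    case 1
    have "(smooth_step has_real_derivative 0) (at t)"
      by (rule has_field_derivative_transform_within_open[OF DERIV_const[of 0], of "{..<0}"])
         (use 1 in \<open>auto simp: smooth_step_eq_0\<close>)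
    then show ?thesis using smooth_step_has_real_derivative DERIV_unique by blast
  next
    case 2
    have "(smooth_step has_real_derivative 0) (at t)"
      by (rule has_field_derivative_transform_within_open[OF DERIV_const[of 1], of "{1<..}"])
         (use 2 in \<open>auto simp: smooth_step_eq_1\<close>)
    then show ?thesis using smooth_step_has_real_derivative DERIV_unique by blast
  qed
qed

text \<open>The bound \<open>K\<close> is the only property of the bump that enters the constants of the estimates.\<close>
lemma bump_bounded: "\<exists>K\<ge>1. \<forall>t. \<bar>bump t\<bar> \<le> K"
proof -
  have "bounded (bump ` {0..1})"
    by (intro compact_imp_bounded compact_continuous_image continuous_on_bump) simp
  then obtain K where K: "\<And>t. t \<in> {0..1} \<Longrightarrow> \<bar>bump t\<bar> \<le> K"
    unfolding bounded_iff by (metis imageI real_norm_def)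
  show ?thesis
  proof (intro exI[of _ "max 1 K"] conjI allI)
    fix t show "\<bar>bump t\<bar> \<le> max 1 K"
      using K[of t] bump_eq_0[of t] by (cases "t \<in> {0..1}") auto
  qed simp
qed

section \<open>Integrals over boxes and Lebesgue norms\<close>

lemma nn_integral_powr_le_Lp_norm:
  assumes "Lp_norm p f \<le> ennreal N" and "0 \<le> N" and "0 < p"
  shows "(\<integral>\<^sup>+x. ennreal (norm (f x) powr p) \<partial>lebesgue) \<le> ennreal (N powr p)"
proof -
  let ?I = "\<integral>\<^sup>+x. ennreal (norm (f x) powr p) \<partial>lebesgue"
  have fin: "?I \<noteq> \<infinity>"
    using assms(1) by (auto simp: Lp_norm_def top_unique)
  then have "enn2real ?I powr (1 / p) \<le> N"
    using assms by (simp add: Lp_norm_def Let_def ennreal_le_iff)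
  then have "(enn2real ?I powr (1 / p)) powr p \<le> N powr p"
    using assms by (intro powr_mono2) auto
  then have "enn2real ?I \<le> N powr p"
    using assms by (simp add: powr_powr)
  then show ?thesis
    using fin by (metis ennreal_enn2real_if ennreal_leI infinity_ennreal_def)
qed

text \<open>
  Hoelder's inequality against an indicator function, up to a factor \<open>2\<close>. It follows by integrating
  \<open>a \<le> t + t powr (1 - p) * a powr p\<close>, which holds for each \<open>t > 0\<close> because the second
  summand is at least \<open>a\<close> as soon as \<open>a > t\<close>.
\<close>
lemma set_nn_integral_le_Lp_norm:
  fixes f :: "'a::euclidean_space \<Rightarrow> 'b::real_normed_vector"
  assumes f: "f \<in> borel_measurable lebesgue" and N: "Lp_norm p f \<le> ennreal N" "0 < N"
    and p: "1 \<le> p" and Q: "Q \<in> sets lebesgue" and m: "emeasure lebesgue Q = ennreal m" "0 < m"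
  shows "(\<integral>\<^sup>+x. ennreal (norm (f x)) * indicator Q x \<partial>lebesgue) \<le> ennreal (2 * N * m powr (1 - 1 / p))"
proof -
  \<comment> \<open>The level at which both summands have the same integral bound.\<close>
  define t where "t = N * m powr (- 1 / p)"
  have t: "0 < t" using N m by (simp add: t_def)
  have pw: "a \<le> t + t powr (1 - p) * a powr p" if "0 \<le> a" for a
  proof (cases "a \<le> t")
    case True
    then show ?thesis by (simp add: add_increasing2)
  next
    case False
    then have "a powr (1 - p) \<le> t powr (1 - p)"
      using p t by (intro powr_mono2') auto
    then have "a powr (1 - p) * a powr p \<le> t powr (1 - p) * a powr p"
      by (intro mult_right_mono) auto
    then show ?thesis
      using False t by (simp flip: powr_add)
  qed
  have "(\<integral>\<^sup>+x. ennreal (norm (f x)) * indicator Q x \<partial>lebesgue)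
      \<le> (\<integral>\<^sup>+x. (ennreal t * indicator Q x + ennreal (t powr (1 - p)) * ennreal (norm (f x) powr p)) \<partial>lebesgue)"
  proof (rule nn_integral_mono)
    fix x
    show "ennreal (norm (f x)) * indicator Q x
        \<le> ennreal t * indicator Q x + ennreal (t powr (1 - p)) * ennreal (norm (f x) powr p)"
      using pw[of "norm (f x)"] t
      by (auto simp: indicator_def simp flip: ennreal_plus ennreal_mult intro!: ennreal_leI)
  qed
  also have "\<dots> = ennreal t * ennreal m
      + ennreal (t powr (1 - p)) * (\<integral>\<^sup>+x. ennreal (norm (f x) powr p) \<partial>lebesgue)"
    using f Q by (subst nn_integral_add) (auto simp: nn_integral_cmult m)
  also have "\<dots> \<le> ennreal t * ennreal m + ennreal (t powr (1 - p)) * ennreal (N powr p)"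
    using N p by (intro add_left_mono mult_left_mono nn_integral_powr_le_Lp_norm) auto
  also have "\<dots> = ennreal (t * m + t powr (1 - p) * N powr p)"
    using t m by (simp add: ennreal_mult ennreal_plus)
  also have "t * m = N * m powr (1 - 1 / p)"
    using m by (simp add: t_def powr_diff powr_minus field_simps)
  also have "t powr (1 - p) * N powr p = N * m powr (1 - 1 / p)"
  proof -
    have "t powr (1 - p) = N powr (1 - p) * m powr (- 1 / p * (1 - p))"
      using N m by (simp add: t_def powr_mult powr_powr)
    moreover have "- 1 / p * (1 - p) = 1 - 1 / p"
      using p by (simp add: field_simps)
    moreover have "N powr (1 - p) * N powr p = N"
      using N by (simp flip: powr_add)
    ultimately show ?thesis by (simp add: mult_ac)
  qed
  finally show ?thesis by (simp add: mult.assoc)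
qed

lemma
  fixes f w :: "'a::euclidean_space \<Rightarrow> real"
  assumes f: "f absolutely_integrable_on cbox a b" and w: "w \<in> borel_measurable borel"
    and bd: "\<And>y. \<bar>w y\<bar> \<le> c" and supp: "\<And>y. y \<notin> cbox a b \<Longrightarrow> w y = 0"
  shows integrable_mult_bounded_kernel: "integrable lebesgue (\<lambda>y. f y * w y)"
    and abs_integral_mult_bounded_kernel_le:
      "\<bar>LINT y|lebesgue. f y * w y\<bar> \<le> c * integral (cbox a b) (\<lambda>y. \<bar>f y\<bar>)"
proof -
  let ?g = "\<lambda>y. indicator (cbox a b) y * f y"
  have g: "integrable lebesgue ?g"
    using f by (simp add: set_integrable_def)
  have w': "w \<in> borel_measurable lebesgue"
    using w by (simp add: measurable_completion)
  have eq: "f y * w y = ?g y * w y" for y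
    using supp[of y] by (auto simp: indicator_def)
  have c: "0 \<le> c" using bd[of undefined] by linarith
  have le: "\<bar>?g y * w y\<bar> \<le> c * \<bar>?g y\<bar>" for y
    using mult_right_mono[OF bd[of y], of "\<bar>?g y\<bar>"] by (simp add: abs_mult mult_ac)
  show i: "integrable lebesgue (\<lambda>y. f y * w y)"
    unfolding eq
    by (rule Bochner_Integration.integrable_bound[where f = "\<lambda>y. c * ?g y"])
       (use g w' le c in \<open>auto simp: abs_mult borel_measurable_integrable\<close>)
  have "\<bar>LINT y|lebesgue. f y * w y\<bar> \<le> (LINT y|lebesgue. \<bar>f y * w y\<bar>)"
    using integral_norm_bound[of lebesgue "\<lambda>y. f y * w y"] by simp
  also have "\<dots> \<le> (LINT y|lebesgue. c * \<bar>?g y\<bar>)"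
    using i g le unfolding eq
    by (intro integral_mono integrable_mult_right integrable_abs) auto
  also have "\<dots> = c * (LINT y|lebesgue. indicator (cbox a b) y *\<^sub>R \<bar>f y\<bar>)"
    by (simp add: abs_mult)
  also have "(LINT y|lebesgue. indicator (cbox a b) y *\<^sub>R \<bar>f y\<bar>) = integral (cbox a b) (\<lambda>y. \<bar>f y\<bar>)"
    using set_lebesgue_integral_eq_integral(2)[of "cbox a b" "\<lambda>y. \<bar>f y\<bar>"]
      set_integrable_abs[OF f]
    by (simp add: set_lebesgue_integral_def)
  finally show "\<bar>LINT y|lebesgue. f y * w y\<bar> \<le> c * integral (cbox a b) (\<lambda>y. \<bar>f y\<bar>)" .
qed

lemma integral_abs_component_le_Lp_norm:
  fixes f :: "'a::euclidean_space \<Rightarrow> 'b::euclidean_space"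
  assumes f: "f \<in> Lp_space p" "f absolutely_integrable_on cbox a b"
    and N: "Lp_norm p f \<le> ennreal N" "0 < N" and p: "1 \<le> p" and e: "norm e \<le> 1"
    and m: "emeasure lebesgue (cbox a b) = ennreal m" "0 < m"
  shows "integral (cbox a b) (\<lambda>y. \<bar>f y \<bullet> e\<bar>) \<le> 2 * N * m powr (1 - 1 / p)"
proof -
  let ?Q = "cbox a b"
  have fe: "set_integrable lebesgue ?Q (\<lambda>y. \<bar>f y \<bullet> e\<bar>)"
    using absolutely_integrable_component[OF f(2)] by (intro set_integrable_abs)
  have "integral ?Q (\<lambda>y. \<bar>f y \<bullet> e\<bar>) = (LINT y|lebesgue. indicator ?Q y *\<^sub>R \<bar>f y \<bullet> e\<bar>)"
    using set_lebesgue_integral_eq_integral(2)[OF fe] by (simp add: set_lebesgue_integral_def)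
  also have "ennreal \<dots> = (\<integral>\<^sup>+y. ennreal (indicator ?Q y *\<^sub>R \<bar>f y \<bullet> e\<bar>) \<partial>lebesgue)"
    using fe by (intro nn_integral_eq_integral[symmetric]) (auto simp: set_integrable_def)
  also have "\<dots> \<le> (\<integral>\<^sup>+y. ennreal (norm (f y)) * indicator ?Q y \<partial>lebesgue)"
  proof (rule nn_integral_mono)
    fix y
    have "\<bar>f y \<bullet> e\<bar> \<le> norm (f y)"
      using Cauchy_Schwarz_ineq2[of "f y" e] mult_left_mono[OF e, of "norm (f y)"] by simp
    then show "ennreal (indicator ?Q y *\<^sub>R \<bar>f y \<bullet> e\<bar>) \<le> ennreal (norm (f y)) * indicator ?Q y"
      by (auto simp: indicator_def intro: ennreal_leI)
  qed
  also have "\<dots> \<le> ennreal (2 * N * m powr (1 - 1 / p))"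
    using f N p m by (intro set_nn_integral_le_Lp_norm) (auto simp: Lp_space_def)
  finally show ?thesis
    using N by (simp add: ennreal_le_iff)
qed

text \<open>
  The form in which norms are used: both \<open>F\<close> itself (with \<open>e = 1\<close>) and the components of its
  gradient are tested against bounded kernels living on a square.
\<close>
lemma abs_integral_component_kernel_le_Lp_norm:
  fixes f :: "'a::euclidean_space \<Rightarrow> 'b::euclidean_space"
  assumes f: "f \<in> Lp_space p" "locally_integrable f"
    and N: "Lp_norm p f \<le> ennreal N" "0 < N" and p: "1 \<le> p" and e: "norm e \<le> 1"
    and m: "emeasure lebesgue (cbox a b) = ennreal m" "0 < m"
    and w: "w \<in> borel_measurable borel" "\<And>y. \<bar>w y\<bar> \<le> c" "\<And>y. y \<notin> cbox a b \<Longrightarrow> w y = 0"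
  shows "\<bar>LINT y|lebesgue. (f y \<bullet> e) * w y\<bar> \<le> 2 * c * N * m powr (1 - 1 / p)"
proof -
  have f': "f absolutely_integrable_on cbox a b"
    using f(2) by (simp add: locally_integrable_def)
  have c: "0 \<le> c" using w(2)[of undefined] by linarith
  have "\<bar>LINT y|lebesgue. (f y \<bullet> e) * w y\<bar> \<le> c * integral (cbox a b) (\<lambda>y. \<bar>f y \<bullet> e\<bar>)"
    using w by (intro abs_integral_mult_bounded_kernel_le absolutely_integrable_component f')
  also have "\<dots> \<le> c * (2 * N * m powr (1 - 1 / p))"
    using c f f' N p e m by (intro mult_left_mono integral_abs_component_le_Lp_norm)
  finally show ?thesis by (simp add: mult_ac)
qed

section \<open>Mollifiers on the plane\<close>

text \<open>
  The point \<open>x\<close> is a corner and not the centre, because the differentiation theorem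
  \<open>integrable_ccontinuous_explicit\<close> is about such squares; all kernels are one-sided accordingly.
\<close>
definition square :: "real^2 \<Rightarrow> real \<Rightarrow> (real^2) set" where
  "square x h = cbox x (x + h *\<^sub>R One)"

lemma mem_square: "y \<in> square x h \<longleftrightarrow> x $ 1 \<le> y $ 1 \<and> y $ 1 \<le> x $ 1 + h \<and> x $ 2 \<le> y $ 2 \<and> y $ 2 \<le> x $ 2 + h"
proof -
  have "(One :: real^2) $ i = 1" for i
  proof -
    have "(One :: real^2) \<bullet> axis i 1 = 1"
      by (rule inner_sum_Basis) simp
    then show ?thesis unfolding inner_axis by simp
  qed
  then show ?thesis
    by (auto simp: square_def mem_box_cart forall_2)
qed

lemma emeasure_square:
  assumes "0 \<le> h"
  shows "emeasure lebesgue (square x h) = ennreal (h\<^sup>2)"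
  using assms by (simp add: square_def emeasure_lborel_cbox_eq inner_add_left)

lemma prod_Basis_vec2:
  fixes f :: "real^2 \<Rightarrow> real"
  shows "(\<Prod>b\<in>Basis. f b) = f (axis 1 1) * f (axis 2 1)"
proof -
  have B: "(Basis :: (real^2) set) = {axis 1 1, axis 2 1}"
    by (auto simp: Basis_vec_def UNIV_2)
  have "axis 1 (1::real) \<noteq> (axis 2 1 :: real^2)"
    by (simp add: axis_eq_axis)
  then show ?thesis unfolding B by simp
qed

lemma integral_lborel_prod_vec2:
  fixes f g :: "real \<Rightarrow> real"
  assumes f: "integrable lborel f" and g: "integrable lborel g"
  shows "(LINT y|lborel. f (y $ 1) * g ((y :: real^2) $ 2)) = (LINT t|lborel. f t) * (LINT t|lborel. g t)"
proof -
  define h where "h b = (if b = axis 1 (1::real) then f else g)" for b :: "real^2"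
  have [measurable]: "f \<in> borel_measurable borel" "g \<in> borel_measurable borel"
    using f g by auto
  have ne: "axis 2 1 \<noteq> (axis 1 1 :: real^2)"
    by (simp add: axis_eq_axis)
  interpret product_sigma_finite "\<lambda>b::real^2. lborel :: real measure"
    by standard
  have "(LINT y|lborel. f (y $ 1) * g ((y :: real^2) $ 2)) = (LINT y|lborel. (\<Prod>b\<in>Basis. h b (y \<bullet> b)))"
    by (simp add: prod_Basis_vec2 h_def ne inner_axis)
  also have "\<dots> = (LINT z|(\<Pi>\<^sub>M b\<in>(Basis::(real^2) set). lborel). (\<Prod>b\<in>Basis. h b (z b)))"
  proof (subst lborel_eq, subst integral_distr)
    have [measurable]: "h b \<in> borel_measurable borel" for b
      by (simp add: h_def)
    show "(\<lambda>y. \<Prod>b\<in>Basis. h b (y \<bullet> b)) \<in> borel_measurable borel"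
      by measurable
  qed auto
  also have "\<dots> = (\<Prod>b\<in>Basis. LINT t|lborel. h b t)"
    by (rule product_integral_prod) (auto simp: h_def f g)
  also have "\<dots> = (LINT t|lborel. f t) * (LINT t|lborel. g t)"
    by (simp add: prod_Basis_vec2 h_def ne)
  finally show ?thesis .
qed

lemma coordinate_product:
  fixes f g f' g' :: "real \<Rightarrow> real"
  assumes f: "\<And>k. Ck k f" "\<And>t. (f has_real_derivative f' t) (at t)"
    and g: "\<And>k. Ck k g" "\<And>t. (g has_real_derivative g' t) (at t)"
  shows Ck_coordinate_product: "Ck k (\<lambda>y::real^2. f (y $ 1) * g (y $ 2))"
    and frechet_derivative_coordinate_product:
      "frechet_derivative (\<lambda>y::real^2. f (y $ 1) * g (y $ 2)) (at y) v
        = f' (y $ 1) * v $ 1 * g (y $ 2) + f (y $ 1) * (g' (y $ 2) * v $ 2)"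
proof -
  show "Ck k (\<lambda>y::real^2. f (y $ 1) * g (y $ 2))"
    using Ck_compose_affine[OF bounded_linear_vec_nth f(1), of k 1 0]
      Ck_compose_affine[OF bounded_linear_vec_nth g(1), of k 2 0]
    by (intro Ck_mult) auto
  have nth: "((\<lambda>y::real^2. y $ i) has_derivative (\<lambda>v. v $ i)) (at y)" for i
    by (rule bounded_linear_imp_has_derivative[OF bounded_linear_vec_nth])
  have "((\<lambda>y::real^2. f (y $ 1) * g (y $ 2)) has_derivative
      (\<lambda>v. f (y $ 1) * (g' (y $ 2) * v $ 2) + f' (y $ 1) * v $ 1 * g (y $ 2))) (at y)"
    using f(2) g(2) unfolding has_field_derivative_def
    by (intro has_derivative_mult has_derivative_compose[OF nth]) auto
  note this_eq = frechet_derivative_at[OF this]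
  show "frechet_derivative (\<lambda>y::real^2. f (y $ 1) * g (y $ 2)) (at y) v
        = f' (y $ 1) * v $ 1 * g (y $ 2) + f (y $ 1) * (g' (y $ 2) * v $ 2)"
    unfolding this_eq[symmetric] by (rule add.commute)
qed

definition scaled_bump :: "real \<Rightarrow> real \<Rightarrow> real \<Rightarrow> real" where
  "scaled_bump r a t = bump ((t - a) / r) / r"

text \<open>A compactly supported primitive of the difference of the bumps at scales \<open>r\<close> and \<open>2 * r\<close>.\<close>
definition ramp :: "real \<Rightarrow> real \<Rightarrow> real \<Rightarrow> real" where
  "ramp r a t = smooth_step ((t - a) / r) - smooth_step ((t - a) / (2 * r))"

definition mollifier :: "real \<Rightarrow> real^2 \<Rightarrow> real^2 \<Rightarrow> real" where
  "mollifier r x y = scaled_bump r (x $ 1) (y $ 1) * scaled_bump r (x $ 2) (y $ 2)"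

lemma Ck_rescale:
  assumes "\<And>k. Ck k f"
  shows "Ck k (\<lambda>t::real. f ((t - a) / r))"
  using Ck_compose_affine[OF bounded_linear_divide assms, of k r "- (a / r)"]
  by (simp add: diff_divide_distrib)

lemma Ck_scaled_bump: "Ck k (scaled_bump r a)"
  using Ck_mult[OF Ck_rescale[OF Ck_bump] Ck_const, of k a r "1 / r"]
  by (simp add: scaled_bump_def[abs_def])

lemma Ck_ramp: "Ck k (ramp r a)"
  using Ck_add[OF Ck_rescale[OF Ck_smooth_step] Ck_mult[OF Ck_const[of k "-1"] Ck_rescale[OF Ck_smooth_step]]]
  by (simp add: ramp_def[abs_def])

lemma borel_measurable_scaled_bump [measurable]: "scaled_bump r a \<in> borel_measurable borel"
  using Ck_scaled_bump[of 0 r a] by (auto intro: borel_measurable_continuous_onI)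

lemma borel_measurable_ramp [measurable]: "ramp r a \<in> borel_measurable borel"
  using Ck_ramp[of 0 r a] by (auto intro: borel_measurable_continuous_onI)

lemma rescaled_smooth_step_has_real_derivative:
  assumes "0 < r"
  shows "((\<lambda>t. smooth_step ((t - a) / r)) has_real_derivative scaled_bump r a t) (at t)"
proof -
  have "((\<lambda>t. (t - a) / r) has_real_derivative 1 / r) (at t)"
    using assms by (auto intro!: derivative_eq_intros)
  from DERIV_chain2[OF smooth_step_has_real_derivative this] show ?thesis
    by (simp add: scaled_bump_def)
qed

lemma ramp_has_real_derivative:
  assumes "0 < r"
  shows "(ramp r a has_real_derivative scaled_bump r a t - scaled_bump (2 * r) a t) (at t)"
  unfolding ramp_def[abs_def] using assms
  by (intro DERIV_diff rescaled_smooth_step_has_real_derivative) auto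

lemma scaled_bump_eq_0: "0 < r \<Longrightarrow> t \<notin> {a..a + r} \<Longrightarrow> scaled_bump r a t = 0"
  by (auto simp: scaled_bump_def field_simps intro!: bump_eq_0)

lemma ramp_eq_0:
  assumes "0 < r" "t \<notin> {a..a + 2 * r}"
  shows "ramp r a t = 0"
proof -
  consider "t < a" | "a + 2 * r < t" using assms(2) by force
  then show ?thesis
    using assms(1) by cases (simp_all add: ramp_def smooth_step_eq_0 smooth_step_eq_1 field_simps)
qed

lemma abs_ramp_le_1: "\<bar>ramp r a t\<bar> \<le> 1"
  using smooth_step_bounds[of "(t - a) / r"] smooth_step_bounds[of "(t - a) / (2 * r)"]
  by (simp add: ramp_def abs_le_iff)

lemma abs_scaled_bump_le:
  assumes "0 < r" "\<And>t. \<bar>bump t\<bar> \<le> K"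
  shows "\<bar>scaled_bump r a t\<bar> \<le> K / r"
  using assms by (simp add: scaled_bump_def divide_right_mono)

lemma has_bochner_integral_scaled_bump:
  assumes "0 < r"
  shows "has_bochner_integral lborel (scaled_bump r a) 1"
proof -
  have "continuous_on UNIV (scaled_bump r a)"
    using Ck_scaled_bump[of 0] by simp
  then have "has_bochner_integral lborel (\<lambda>t. scaled_bump r a t * indicator {a..a + r} t)
      (smooth_step ((a + r - a) / r) - smooth_step ((a - a) / r))"
    using assms rescaled_smooth_step_has_real_derivative[OF assms]
    by (intro has_bochner_integral_FTC_Icc_real) (auto simp: continuous_on_eq_continuous_at)
  moreover have "scaled_bump r a t * indicator {a..a + r} t = scaled_bump r a t" for t
    using scaled_bump_eq_0[OF assms, of t a] by (auto simp: indicator_def)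
  moreover have "smooth_step ((a + r - a) / r) - smooth_step ((a - a) / r) = 1"
    using assms by (simp add: smooth_step_eq_0 smooth_step_eq_1)
  ultimately show ?thesis by (simp only:)
qed

lemma integral_mollifier:
  assumes "0 < r"
  shows "(LINT y|lebesgue. mollifier r x y) = 1"
proof -
  have "(LINT y|lebesgue. mollifier r x y) = (LINT y|lborel. mollifier r x y)"
    by (rule integral_completion) (simp add: mollifier_def)
  then show ?thesis
    using integral_lborel_prod_vec2[of "scaled_bump r (x $ 1)" "scaled_bump r (x $ 2)"]
      has_bochner_integral_scaled_bump[OF assms]
    by (simp add: mollifier_def has_bochner_integral_iff)
qed

lemma borel_measurable_mollifier: "mollifier r x \<in> borel_measurable borel"
  by (simp add: mollifier_def[abs_def])

lemma mollifier_eq_0: "0 < r \<Longrightarrow> y \<notin> square x r \<Longrightarrow> mollifier r x y = 0"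
  using scaled_bump_eq_0[of r "y $ 1" "x $ 1"] scaled_bump_eq_0[of r "y $ 2" "x $ 2"]
  by (auto simp: mollifier_def mem_square)

lemma abs_mollifier_le:
  assumes "0 < r" "\<And>t. \<bar>bump t\<bar> \<le> K"
  shows "\<bar>mollifier r x y\<bar> \<le> (K / r)\<^sup>2"
  unfolding mollifier_def abs_mult power2_eq_square
  using abs_scaled_bump_le[OF assms] by (intro mult_mono) (auto intro: order_trans[OF abs_ge_zero])

lemma compact_support_in_square:
  assumes "\<And>y. y \<notin> square x h \<Longrightarrow> \<phi> y = 0"
  shows "compact (closure {y. \<phi> y \<noteq> 0})"
proof -
  have "{y. \<phi> y \<noteq> 0} \<subseteq> square x h"
    using assms by blast
  then have "bounded {y. \<phi> y \<noteq> 0}"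
    unfolding square_def by (rule bounded_subset[OF bounded_cbox])
  then show ?thesis by (simp add: compact_closure)
qed

lemma absolutely_integrable_on_square:
  "locally_integrable f \<Longrightarrow> f absolutely_integrable_on square x h"
  by (simp add: locally_integrable_def square_def)

section \<open>Comparing the scales\<close>

definition mollified :: "real \<Rightarrow> (real^2 \<Rightarrow> real) \<Rightarrow> real^2 \<Rightarrow> real" where
  "mollified r F x = (LINT y|lebesgue. F y * mollifier r x y)"

text \<open>
  With \<open>b\<^sub>i\<close>, \<open>B\<^sub>i\<close> the bumps in coordinate \<open>i\<close> at the scales \<open>r\<close>, \<open>2 * r\<close>, the difference of the
  kernels telescopes as \<open>b\<^sub>1 * b\<^sub>2 - B\<^sub>1 * B\<^sub>2 = (b\<^sub>1 - B\<^sub>1) * b\<^sub>2 + B\<^sub>1 * (b\<^sub>2 - B\<^sub>2)\<close>. Replacing each bracket by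
  its primitive writes this as the divergence of a field of two test functions, to which the
  definition of the weak gradient applies directly.
\<close>
lemma mollified_diff_eq:
  assumes G: "has_weak_gradient F G" and r: "0 < r"
  shows "mollified (2 * r) F x - mollified r F x
    = (LINT y|lebesgue. (G y \<bullet> axis 1 1) * (ramp r (x $ 1) (y $ 1) * scaled_bump r (x $ 2) (y $ 2)))
      + (LINT y|lebesgue. (G y \<bullet> axis 2 1) * (scaled_bump (2 * r) (x $ 1) (y $ 1) * ramp r (x $ 2) (y $ 2)))"
proof -
  let ?Q = "square x (2 * r)"
  let ?b = "\<lambda>i y::real^2. scaled_bump r (x $ i) (y $ i)"
  let ?b2 = "\<lambda>i y::real^2. scaled_bump (2 * r) (x $ i) (y $ i)"
  let ?h = "\<lambda>i y::real^2. ramp r (x $ i) (y $ i)"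
  define \<phi> where "\<phi> y = ?h 1 y * ?b 2 y" for y
  define \<psi> where "\<psi> y = ?b2 1 y * ?h 2 y" for y
  have F: "F absolutely_integrable_on ?Q"
    using G by (simp add: has_weak_gradient_def absolutely_integrable_on_square)
  have sb: "(scaled_bump s a has_real_derivative frechet_derivative (scaled_bump s a) (at t) 1) (at t)" for s a t
    by (rule Ck_Suc_has_real_derivative[OF Ck_scaled_bump])
  have out: "ramp r (x $ i) (y $ i) = 0 \<or> scaled_bump s (x $ j) (y $ j) = 0"
    if "y \<notin> ?Q" "{i, j} = {1, 2}" "s \<in> {r, 2 * r}" for y i j s
  proof -
    have "y $ i \<notin> {x $ i .. x $ i + 2 * r} \<or> y $ j \<notin> {x $ j .. x $ j + 2 * r}"
      using that(1,2) by (auto simp: mem_square doubleton_eq_iff)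
    then show ?thesis
      using ramp_eq_0[OF r, of "y $ i" "x $ i"] scaled_bump_eq_0[of s "y $ j" "x $ j"] that(3) r by force
  qed
  have \<phi>_0: "\<phi> y = 0" if "y \<notin> ?Q" for y
    using out[OF that, of 1 2 r] by (auto simp: \<phi>_def)
  have \<psi>_0: "\<psi> y = 0" if "y \<notin> ?Q" for y
    using out[OF that, of 2 1 "2 * r"] by (auto simp: \<psi>_def)
  have "test_function \<phi>" "test_function \<psi>"
    unfolding test_function_def
    using compact_support_in_square[OF \<phi>_0] compact_support_in_square[OF \<psi>_0]
      Ck_coordinate_product[OF Ck_ramp ramp_has_real_derivative[OF r] Ck_scaled_bump sb]
      Ck_coordinate_product[OF Ck_scaled_bump sb Ck_ramp ramp_has_real_derivative[OF r]]
    by (auto simp: \<phi>_def[abs_def] \<psi>_def[abs_def])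
  then have ibp:
    "(LINT y|lebesgue. F y * frechet_derivative \<phi> (at y) (axis 1 1)) = - (LINT y|lebesgue. (G y \<bullet> axis 1 1) * \<phi> y)"
    "(LINT y|lebesgue. F y * frechet_derivative \<psi> (at y) (axis 2 1)) = - (LINT y|lebesgue. (G y \<bullet> axis 2 1) * \<psi> y)"
    using G by (auto simp: has_weak_gradient_def)
  have d\<phi>: "frechet_derivative \<phi> (at y) (axis 1 1) = (?b 1 y - ?b2 1 y) * ?b 2 y" for y
    using frechet_derivative_coordinate_product[OF Ck_ramp ramp_has_real_derivative[OF r] Ck_scaled_bump sb]
    by (simp add: \<phi>_def[abs_def] axis_def)
  have d\<psi>: "frechet_derivative \<psi> (at y) (axis 2 1) = ?b2 1 y * (?b 2 y - ?b2 2 y)" for y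
    using frechet_derivative_coordinate_product[OF Ck_scaled_bump sb Ck_ramp ramp_has_real_derivative[OF r]]
    by (simp add: \<psi>_def[abs_def] axis_def)
  obtain K where K: "1 \<le> K" "\<And>t. \<bar>bump t\<bar> \<le> K"
    using bump_bounded by blast
  have int: "integrable lebesgue (\<lambda>y. F y * (scaled_bump s (x $ 1) (y $ 1) * scaled_bump s' (x $ 2) (y $ 2)))"
    if "s \<in> {r, 2 * r}" "s' \<in> {r, 2 * r}" for s s'
  proof (rule integrable_mult_bounded_kernel[OF F[unfolded square_def]])
    show "\<bar>scaled_bump s (x $ 1) (y $ 1) * scaled_bump s' (x $ 2) (y $ 2)\<bar> \<le> (K / s) * (K / s')" for y
      unfolding abs_mult using K r that
      by (intro mult_mono abs_scaled_bump_le) auto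
    show "scaled_bump s (x $ 1) (y $ 1) * scaled_bump s' (x $ 2) (y $ 2) = 0"
      if "y \<notin> cbox x (x + (2 * r) *\<^sub>R One)" for y
      using scaled_bump_eq_0[of s "y $ 1" "x $ 1"] scaled_bump_eq_0[of s' "y $ 2" "x $ 2"] r
        that[folded square_def] \<open>s \<in> {r, 2 * r}\<close> \<open>s' \<in> {r, 2 * r}\<close>
      by (force simp: mem_square)
  qed measurable
  have "mollified r F x - mollified (2 * r) F x
      = (LINT y|lebesgue. F y * (?b 1 y * ?b 2 y) - F y * (?b2 1 y * ?b2 2 y))"
    unfolding mollified_def mollifier_def
    using int by (intro Bochner_Integration.integral_diff[symmetric]) auto
  also have "\<dots> = (LINT y|lebesgue. F y * frechet_derivative \<phi> (at y) (axis 1 1)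
                              + F y * frechet_derivative \<psi> (at y) (axis 2 1))"
    by (simp add: d\<phi> d\<psi> algebra_simps)
  also have "\<dots> = (LINT y|lebesgue. F y * frechet_derivative \<phi> (at y) (axis 1 1))
                  + (LINT y|lebesgue. F y * frechet_derivative \<psi> (at y) (axis 2 1))"
    unfolding d\<phi> d\<psi> left_diff_distrib right_diff_distrib
    using int by (intro Bochner_Integration.integral_add Bochner_Integration.integrable_diff) auto
  finally show ?thesis
    unfolding ibp by (simp add: \<phi>_def \<psi>_def)
qed

lemma abs_mollified_le:
  assumes F: "F \<in> Lp_space q" "locally_integrable F" and N: "Lp_norm q F \<le> ennreal N" "0 < N"
    and q: "1 \<le> q" and r: "0 < r" and K: "\<And>t. \<bar>bump t\<bar> \<le> K"
  shows "\<bar>mollified r F x\<bar> \<le> 2 * K\<^sup>2 * N * r powr (- 2 / q)"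
proof -
  have "\<bar>LINT y|lebesgue. (F y \<bullet> 1) * mollifier r x y\<bar> \<le> 2 * (K / r)\<^sup>2 * N * (r\<^sup>2) powr (1 - 1 / q)"
  proof (rule abs_integral_component_kernel_le_Lp_norm[OF F N q])
    show "emeasure lebesgue (cbox x (x + r *\<^sub>R One)) = ennreal (r\<^sup>2)"
      using emeasure_square[of r x] r by (simp add: square_def)
    show "mollifier r x y = 0" if "y \<notin> cbox x (x + r *\<^sub>R One)" for y
      using mollifier_eq_0[OF r] that by (simp add: square_def)
  qed (use r K abs_mollifier_le in \<open>auto intro: borel_measurable_mollifier\<close>)
  moreover have "(r\<^sup>2) powr (1 - 1 / q) = r\<^sup>2 * r powr (- 2 / q)"
  proof -
    have "(r\<^sup>2) powr (1 - 1 / q) = r powr (2 + - 2 / q)"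
      using r by (simp add: powr_powr field_simps flip: powr_numeral)
    then show ?thesis
      using r by (simp only: powr_add) simp
  qed
  ultimately show ?thesis
    using r by (simp add: mollified_def field_simps)
qed

text \<open>
  Both test functions are of size \<open>1 / r\<close> on a square of side \<open>2 * r\<close>, so pairing them with the
  gradient costs \<open>r powr (- 1) * r powr (2 - 2 / p)\<close>. The total exponent \<open>1 - 2 / p\<close> is positive
  exactly for \<open>p > 2\<close>, which is what makes the sum over dyadic scales converge.
\<close>
lemma abs_mollified_diff_le:
  assumes G: "has_weak_gradient F G" "G \<in> Lp_space p" and N: "Lp_norm p G \<le> ennreal N" "0 < N"
    and p: "1 \<le> p" and r: "0 < r" and K: "1 \<le> K" "\<And>t. \<bar>bump t\<bar> \<le> K"
  shows "\<bar>mollified (2 * r) F x - mollified r F x\<bar> \<le> 16 * K * N * r powr (1 - 2 / p)"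
proof -
  let ?Q = "square x (2 * r)"
  have lG: "locally_integrable G"
    using G(1) by (simp add: has_weak_gradient_def)
  have sb: "\<bar>scaled_bump s a t\<bar> \<le> K / r" if "r \<le> s" for s a t
  proof -
    have "\<bar>scaled_bump s a t\<bar> \<le> K / s"
      using that r K by (intro abs_scaled_bump_le) auto
    also have "\<dots> \<le> K / r"
      using that r K by (intro divide_left_mono) auto
    finally show ?thesis .
  qed
  have m: "emeasure lebesgue (cbox x (x + (2 * r) *\<^sub>R One)) = ennreal ((2 * r)\<^sup>2)"
    using emeasure_square[of "2 * r" x] r by (simp add: square_def)
  have meas: "((2 * r)\<^sup>2) powr (1 - 1 / p) \<le> 4 * r * r powr (1 - 2 / p)"
  proof -
    have "((2 * r)\<^sup>2) powr (1 - 1 / p) = (2 * r) powr (2 * (1 - 1 / p))"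
    proof -
      have "(2 * r)\<^sup>2 = (2 * r) powr 2" using r by simp
      then show ?thesis by (simp only: powr_powr)
    qed
    also have "\<dots> = 2 powr (2 * (1 - 1 / p)) * r powr (1 + (1 - 2 / p))"
      using r by (simp add: powr_mult algebra_simps)
    also have "2 powr (2 * (1 - 1 / p)) \<le> 2 powr (2::real)"
      using p by (intro powr_mono) auto
    finally have "((2 * r)\<^sup>2) powr (1 - 1 / p) \<le> 2 powr 2 * r powr (1 + (1 - 2 / p))"
      by (simp add: mult_right_mono)
    also have "\<dots> = 4 * (r powr 1 * r powr (1 - 2 / p))"
      unfolding powr_add by simp
    finally show ?thesis
      using r by simp
  qed
  have b: "2 * (K / r) * N * ((2 * r)\<^sup>2) powr (1 - 1 / p) \<le> 8 * K * N * r powr (1 - 2 / p)"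
  proof -
    have "2 * (K / r) * N * ((2 * r)\<^sup>2) powr (1 - 1 / p) \<le> 2 * (K / r) * N * (4 * r * r powr (1 - 2 / p))"
      using K N r by (intro mult_left_mono meas) auto
    then show ?thesis using r by simp
  qed
  have "\<bar>LINT y|lebesgue. (G y \<bullet> axis 1 1) * (ramp r (x $ 1) (y $ 1) * scaled_bump r (x $ 2) (y $ 2))\<bar>
      \<le> 2 * (K / r) * N * ((2 * r)\<^sup>2) powr (1 - 1 / p)"
  proof (rule abs_integral_component_kernel_le_Lp_norm[OF G(2) lG N p _ m])
    show "\<bar>ramp r (x $ 1) (y $ 1) * scaled_bump r (x $ 2) (y $ 2)\<bar> \<le> K / r" for y
      using mult_mono[OF abs_ramp_le_1 sb[of r "x $ 2" "y $ 2"]] by (simp add: abs_mult)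
    show "ramp r (x $ 1) (y $ 1) * scaled_bump r (x $ 2) (y $ 2) = 0"
      if "y \<notin> cbox x (x + (2 * r) *\<^sub>R One)" for y
      using ramp_eq_0[OF r, of "y $ 1" "x $ 1"] scaled_bump_eq_0[OF r, of "y $ 2" "x $ 2"] r
        that[folded square_def] by (force simp: mem_square)
  qed (use r in auto)
  moreover have "\<bar>LINT y|lebesgue. (G y \<bullet> axis 2 1) * (scaled_bump (2 * r) (x $ 1) (y $ 1) * ramp r (x $ 2) (y $ 2))\<bar>
      \<le> 2 * (K / r) * N * ((2 * r)\<^sup>2) powr (1 - 1 / p)"
  proof (rule abs_integral_component_kernel_le_Lp_norm[OF G(2) lG N p _ m])
    show "\<bar>scaled_bump (2 * r) (x $ 1) (y $ 1) * ramp r (x $ 2) (y $ 2)\<bar> \<le> K / r" for y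
      using mult_mono[OF sb[of "2 * r" "x $ 1" "y $ 1"] abs_ramp_le_1] r K by (simp add: abs_mult)
    show "scaled_bump (2 * r) (x $ 1) (y $ 1) * ramp r (x $ 2) (y $ 2) = 0"
      if "y \<notin> cbox x (x + (2 * r) *\<^sub>R One)" for y
      using ramp_eq_0[OF r, of "y $ 2" "x $ 2"] scaled_bump_eq_0[of "2 * r" "y $ 1" "x $ 1"] r
        that[folded square_def] by (force simp: mem_square)
  qed (use r in auto)
  ultimately show ?thesis
    unfolding mollified_diff_eq[OF G(1) r] using b by linarith
qed

lemma abs_mollified_dyadic_diff_le:
  assumes G: "has_weak_gradient F G" "G \<in> Lp_space p" and N: "Lp_norm p G \<le> ennreal N" "0 < N"
    and p: "2 < p" and r: "0 < r" and K: "1 \<le> K" "\<And>t. \<bar>bump t\<bar> \<le> K"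
  shows "\<bar>mollified (r / 2 ^ k) F x - mollified r F x\<bar>
    \<le> 16 * K * N * r powr (1 - 2 / p) / (1 - 2 powr (- (1 - 2 / p)))"
proof -
  define \<alpha> where "\<alpha> = 1 - 2 / p"
  define \<theta> where "\<theta> = 2 powr (- \<alpha>)"
  have \<alpha>: "0 < \<alpha>" using p by (simp add: \<alpha>_def)
  have \<theta>: "0 < \<theta>" "\<theta> < 1"
    using \<alpha> powr_less_mono[of "- \<alpha>" 0 2] by (auto simp: \<theta>_def)
  let ?M = "16 * K * N * r powr \<alpha>"
  have M: "0 \<le> ?M" using K N by simp
  have dyadic: "\<bar>mollified (r / 2 ^ Suc j) F x - mollified (r / 2 ^ j) F x\<bar> \<le> ?M * \<theta> ^ j" for j
  proof -
    have "\<bar>mollified (2 * (r / 2 ^ Suc j)) F x - mollified (r / 2 ^ Suc j) F x\<bar>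
        \<le> 16 * K * N * (r / 2 ^ Suc j) powr (1 - 2 / p)"
      using p r by (intro abs_mollified_diff_le[OF G N _ _ K]) auto
    also have "\<dots> \<le> 16 * K * N * (r / 2 ^ j) powr \<alpha>"
      unfolding \<alpha>_def[symmetric] using K N r \<alpha>
      by (intro mult_left_mono powr_mono2) (auto simp: field_simps)
    also have "(r / 2 ^ j) powr \<alpha> = r powr \<alpha> * \<theta> ^ j"
    proof -
      have "(2 ^ j) powr \<alpha> = (2 powr \<alpha>) ^ j"
        by (simp add: powr_powr mult.commute flip: powr_realpow)
      then have "(r / 2 ^ j) powr \<alpha> = r powr \<alpha> / (2 powr \<alpha>) ^ j"
        using r by (simp add: powr_divide)
      then show ?thesis
        by (simp add: \<theta>_def powr_minus power_inverse divide_inverse)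
    qed
    finally show ?thesis
      by (simp add: abs_minus_commute mult.assoc)
  qed
  have "\<bar>mollified (r / 2 ^ k) F x - mollified r F x\<bar> \<le> (\<Sum>j<k. ?M * \<theta> ^ j)"
  proof (induction k)
    case (Suc k)
    then show ?case using dyadic[of k] by simp
  qed simp
  also have "\<dots> \<le> (\<Sum>j. ?M * \<theta> ^ j)"
    using M \<theta> by (intro sum_le_suminf summable_mult summable_geometric) auto
  also have "\<dots> = ?M / (1 - \<theta>)"
    using \<theta> by (subst suminf_mult) (auto simp: suminf_geometric summable_geometric)
  finally show ?thesis
    by (simp add: \<alpha>_def \<theta>_def)
qed

text \<open>
  A Lebesgue point argument that needs averages over squares only. For rational \<open>c\<close> near \<open>F x\<close>,
  the mollified value differs from \<open>c\<close> by at most \<open>K\<^sup>2\<close> times the average of \<open>\<bar>F - c\<bar>\<close> over a small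
  square at \<open>x\<close>, and for almost every \<open>x\<close> these averages tend to the small number \<open>\<bar>F x - c\<bar>\<close>.
  Rational \<open>c\<close> keep the union of the exceptional sets negligible.
\<close>
lemma AE_abs_le_if_mollified_le:
  fixes s :: "nat \<Rightarrow> real"
  assumes F: "locally_integrable F" and s: "\<And>k. 0 < s k" "s \<longlonglongrightarrow> 0"
    and B: "\<And>k x. \<bar>mollified (s k) F x\<bar> \<le> B"
  shows "AE x in lebesgue. \<bar>F x\<bar> \<le> B"
proof -
  obtain K where K: "1 \<le> K" "\<And>t. \<bar>bump t\<bar> \<le> K"
    using bump_bounded by blast
  have F': "(\<lambda>y. F y - c) absolutely_integrable_on square x h" for c x h
    using absolutely_integrable_on_square[OF F]
    by (intro set_integral_diff(1)) (auto simp: square_def)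
  \<comment> \<open>\<open>N\<close> is an exceptional set for the differentiation of \<open>\<bar>F - c\<bar>\<close> over squares.\<close>
  define P where "P N c \<longleftrightarrow> negligible N \<and>
    (\<forall>x e. x \<notin> N \<longrightarrow> 0 < e \<longrightarrow> (\<exists>d>0. \<forall>h. 0 < h \<and> h < d \<longrightarrow>
      norm (integral (cbox x (x + h *\<^sub>R One)) (\<lambda>y. \<bar>F y - c\<bar>) /\<^sub>R h ^ DIM(real^2) - \<bar>F x - c\<bar>) < e))"
    for N :: "(real^2) set" and c :: real
  have "\<exists>N. P N c" for c
  proof -
    have "(\<lambda>y. \<bar>F y - c\<bar>) integrable_on cbox a b" for a b
    proof -
      have "F absolutely_integrable_on cbox a b" using F by (simp add: locally_integrable_def)
      then have "(\<lambda>y. F y - c) absolutely_integrable_on cbox a b"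
        by (intro set_integral_diff(1)) auto
      then show ?thesis
        by (rule set_lebesgue_integral_eq_integral(1)[OF set_integrable_abs])
    qed
    then obtain N' where N': "negligible N'"
      "\<And>x e. x \<notin> N' \<Longrightarrow> 0 < e \<Longrightarrow> \<exists>d>0. \<forall>h. 0 < h \<and> h < d \<longrightarrow>
        norm (integral (cbox x (x + h *\<^sub>R One)) (\<lambda>y. \<bar>F y - c\<bar>) /\<^sub>R h ^ DIM(real^2) - \<bar>F x - c\<bar>) < e"
      by (rule integrable_ccontinuous_explicit) (rule that)
    show ?thesis
      unfolding P_def by (intro exI[of _ N'] conjI allI impI N')
  qed
  then obtain N where N: "\<And>c. P (N c) c" by metis
  have "negligible (\<Union>c\<in>\<rat>. N c)"
    using N by (intro negligible_countable_Union) (auto simp: countable_rat P_def)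
  then have "AE x in lebesgue. x \<notin> (\<Union>c\<in>\<rat>. N c)"
    by (intro AE_not_in) (simp only: negligible_iff_null_sets)
  then show ?thesis
  proof eventually_elim
    case (elim x)
    have "\<bar>F x\<bar> \<le> B + e" if "0 < e" for e
    proof -
      \<comment> \<open>The error is at most \<open>2 * K\<^sup>2 * e' + e'\<close>.\<close>
      define e' where "e' = e / (1 + 2 * K\<^sup>2)"
      have "0 < 1 + 2 * K\<^sup>2"
        by (simp add: add_pos_nonneg)
      then have e': "0 < e'" "(1 + 2 * K\<^sup>2) * e' = e"
        using that by (auto simp: e'_def)
      obtain c where c: "c \<in> \<rat>" "\<bar>F x - c\<bar> < e'"
        using Rats_dense_in_real[of "F x - e'" "F x + e'"] e' by (auto simp: abs_less_iff algebra_simps)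
      then have "x \<notin> N c" using elim by blast
      then obtain d where d: "0 < d" "\<And>h. 0 < h \<Longrightarrow> h < d \<Longrightarrow>
          norm (integral (cbox x (x + h *\<^sub>R One)) (\<lambda>y. \<bar>F y - c\<bar>) /\<^sub>R h ^ DIM(real^2) - \<bar>F x - c\<bar>) < e'"
        using N[of c] e' unfolding P_def by blast
      obtain k where k: "s k < d"
        using order_tendstoD(2)[OF s(2) d(1)] eventually_sequentially by auto
      let ?Q = "square x (s k)"
      have "integral ?Q (\<lambda>y. \<bar>F y - c\<bar>) / (s k)\<^sup>2 < 2 * e'"
        using d(2)[OF s(1) k] c(2) by (simp add: square_def divide_inverse mult.commute) 
      then have avg: "integral ?Q (\<lambda>y. \<bar>F y - c\<bar>) \<le> 2 * e' * (s k)\<^sup>2"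
        using s(1)[of k] by (simp add: divide_less_eq)
      have m: "\<And>y. \<bar>mollifier (s k) x y\<bar> \<le> (K / s k)\<^sup>2" "\<And>y. y \<notin> ?Q \<Longrightarrow> mollifier (s k) x y = 0"
        using abs_mollifier_le[OF s(1) K(2)] mollifier_eq_0[OF s(1)] by auto
      have i: "integrable lebesgue (\<lambda>y. g y * mollifier (s k) x y)"
        if "g absolutely_integrable_on ?Q" for g
        using integrable_mult_bounded_kernel[OF that[unfolded square_def] borel_measurable_mollifier m(1)] m(2)
        by (simp add: square_def)
      have "(LINT y|lebesgue. (F y - c) * mollifier (s k) x y)
          = mollified (s k) F x - (LINT y|lebesgue. c * mollifier (s k) x y)"
        unfolding left_diff_distrib mollified_def
        using absolutely_integrable_on_square[OF F, of x "s k"]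
        by (intro Bochner_Integration.integral_diff i) (auto simp: square_def)
      then have "(LINT y|lebesgue. (F y - c) * mollifier (s k) x y) = mollified (s k) F x - c"
        by (simp add: integral_mollifier[OF s(1)])
      moreover have "\<bar>LINT y|lebesgue. (F y - c) * mollifier (s k) x y\<bar>
          \<le> (K / s k)\<^sup>2 * integral ?Q (\<lambda>y. \<bar>F y - c\<bar>)"
        using abs_integral_mult_bounded_kernel_le[OF F'[unfolded square_def] borel_measurable_mollifier m(1)] m(2)
        by (simp add: square_def)
      moreover have "(K / s k)\<^sup>2 * integral ?Q (\<lambda>y. \<bar>F y - c\<bar>) \<le> 2 * K\<^sup>2 * e'"
        using mult_left_mono[OF avg, of "(K / s k)\<^sup>2"] s(1)[of k] by (simp add: field_simps)
      ultimately have "\<bar>F x\<bar> \<le> B + (2 * K\<^sup>2 * e' + e')"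
        using B[of k x] c(2) by linarith
      also have "2 * K\<^sup>2 * e' + e' = e"
        using e'(2) by (simp add: algebra_simps)
      finally show ?thesis .
    qed
    then show ?case by (rule field_le_epsilon)
  qed
qed

section \<open>The logarithmic inequality\<close>

text \<open>
  The scale \<open>r\<close> is free: the first term bounds the mean of \<open>F\<close> at that scale, the second one
  its oscillation below that scale.
\<close>
proposition AE_abs_le_Lp_norm_and_gradient:
  fixes F :: "real^2 \<Rightarrow> real"
  assumes F: "F \<in> Lp_space q" "Lp_norm q F \<le> ennreal N" "0 < N" "1 \<le> q"
    and G: "has_weak_gradient F G" "G \<in> Lp_space p" "Lp_norm p G \<le> ennreal N'" "0 < N'" "2 < p"
    and r: "0 < r" and K: "1 \<le> K" "\<And>t. \<bar>bump t\<bar> \<le> K"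
  shows "AE x in lebesgue. \<bar>F x\<bar> \<le> 2 * K\<^sup>2 * N * r powr (- 2 / q)
    + 16 * K * N' * r powr (1 - 2 / p) / (1 - 2 powr (- (1 - 2 / p)))"
proof (rule AE_abs_le_if_mollified_le)
  show lF: "locally_integrable F"
    using G(1) by (simp add: has_weak_gradient_def)
  show "0 < r / 2 ^ k" for k using r by simp
  have "(\<lambda>k. r * (1 / 2) ^ k) \<longlonglongrightarrow> r * 0"
    by (intro tendsto_mult tendsto_const LIMSEQ_realpow_zero) auto
  then show "(\<lambda>k. r / 2 ^ k) \<longlonglongrightarrow> 0"
    by (simp add: power_one_over)
  show "\<bar>mollified (r / 2 ^ k) F x\<bar> \<le> 2 * K\<^sup>2 * N * r powr (- 2 / q)
    + 16 * K * N' * r powr (1 - 2 / p) / (1 - 2 powr (- (1 - 2 / p)))" for k x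
    using abs_mollified_le[OF F(1) lF F(2-4) r K(2), of x]
      abs_mollified_dyadic_diff_le[OF G r K, of k x] by linarith
qed

lemma ennreal_le_mult_if_divide_le:
  assumes "0 < c" and "x / ennreal c \<le> y"
  shows "x \<le> y * ennreal c"
proof -
  have "x / ennreal c * ennreal c = x * ennreal (inverse c * c)"
    using assms(1) by (simp only: divide_ennreal_def mult.assoc inverse_ennreal
        ennreal_mult[OF less_imp_le[OF positive_imp_inverse_positive] less_imp_le])
  also have "\<dots> = x"
    using assms(1) by simp
  finally have "x = x / ennreal c * ennreal c" by simp
  also have "\<dots> \<le> y * ennreal c"
    using assms(2) by (rule mult_right_mono) simp
  finally show ?thesis .
qed

theorem lemma2p1:
  shows "\<exists>C>0::real. \<forall>\<delta>>0::real. \<forall>lam>0::real. \<exists>D>0::real.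
    \<forall>F :: real^2 \<Rightarrow> real. \<forall>R>0::real. F \<in> Sobolev_W1 (2 + \<delta>) \<longrightarrow>
      Linf_norm F \<le>
        ennreal D
        * max 1 (SUP q\<in>{2::real..}. Lp_norm q F / ennreal (q powr lam * R powr (2 / q)))
        * ennreal ((ln ((exp 1)\<^sup>2 + C * R powr (\<delta> / (2 + \<delta>)) *
            (enn2real (Lp_norm (2 + \<delta>) F) / R
             + enn2real (Lp_norm (2 + \<delta>) (weak_gradient F))))) powr lam)"
proof -
  obtain K where K: "1 \<le> K" "\<And>t. \<bar>bump t\<bar> \<le> K"
    using bump_bounded by blast
  show ?thesis
  proof (rule exI[of _ "1::real"], intro conjI allI impI)
    fix \<delta> lam :: real
    assume \<delta>: "0 < \<delta>" and lam: "0 < lam"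
    define p where "p = 2 + \<delta>"
    \<comment> \<open>The Hoelder exponent of the Morrey embedding.\<close>
    define \<alpha> where "\<alpha> = \<delta> / (2 + \<delta>)"
    have p: "2 < p" and \<alpha>: "0 < \<alpha>" and p\<alpha>: "1 - 2 / p = \<alpha>"
      using \<delta> by (auto simp: p_def \<alpha>_def field_simps)
    define T where "T = 16 * K / (1 - 2 powr (- \<alpha>))"
    define D where "D = 2 * K\<^sup>2 * 2 powr lam * exp (1 / \<alpha>) + T"
    have "2 powr (- \<alpha>) < 1"
      using \<alpha> powr_less_mono[of "- \<alpha>" 0 2] by simp
    then have T: "0 \<le> T" using K by (simp add: T_def)
    then have D: "0 < D"
      using K by (auto simp: D_def intro!: add_pos_nonneg)
    show "\<exists>D>0. \<forall>F :: real^2 \<Rightarrow> real. \<forall>R>0. F \<in> Sobolev_W1 (2 + \<delta>) \<longrightarrow>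
      Linf_norm F \<le>
        ennreal D
        * max 1 (SUP q\<in>{2::real..}. Lp_norm q F / ennreal (q powr lam * R powr (2 / q)))
        * ennreal ((ln ((exp 1)\<^sup>2 + 1 * R powr (\<delta> / (2 + \<delta>)) *
            (enn2real (Lp_norm (2 + \<delta>) F) / R
             + enn2real (Lp_norm (2 + \<delta>) (weak_gradient F))))) powr lam)"
      unfolding \<alpha>_def[symmetric]
      unfolding p_def[symmetric]
    proof (intro exI[of _ D] conjI allI impI D)
      fix F :: "real^2 \<Rightarrow> real" and R :: real
      assume R: "0 < R" and F: "F \<in> Sobolev_W1 p"
      define G where "G = weak_gradient F"
      define g where "g = enn2real (Lp_norm p G)"
      define S where "S = max 1 (SUP q\<in>{2::real..}. Lp_norm q F / ennreal (q powr lam * R powr (2 / q)))"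
      define X where "X = 1 * R powr \<alpha> * (enn2real (Lp_norm p F) / R + g)"
      define L where "L = ln ((exp 1)\<^sup>2 + X)"
      have G: "has_weak_gradient F G" "G \<in> Lp_space p" and Fm: "F \<in> borel_measurable lebesgue"
        using F someI_ex[of "has_weak_gradient F"]
        by (auto simp: Sobolev_W1_def G_def weak_gradient_def Lp_space_def)
      have g: "0 \<le> g" and "R powr \<alpha> * g \<le> X"
        using R by (auto simp: g_def X_def intro!: mult_left_mono)
      moreover have "0 \<le> R powr \<alpha> * g" using g by simp
      ultimately have X: "0 \<le> X" by linarith
      have "ln ((exp 1)\<^sup>2) \<le> L"
        unfolding L_def using X by (intro ln_mono) (auto intro: add_pos_nonneg)
      then have L: "2 \<le> L" by (simp add: ln_realpow)
      show "Linf_norm F \<le> ennreal D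
        * max 1 (SUP q\<in>{2::real..}. Lp_norm q F / ennreal (q powr lam * R powr (2 / q)))
        * ennreal ((ln ((exp 1)\<^sup>2 + 1 * R powr \<alpha> *
            (enn2real (Lp_norm p F) / R + enn2real (Lp_norm p (weak_gradient F))))) powr lam)"
        unfolding S_def[symmetric] G_def[symmetric] g_def[symmetric]
        unfolding X_def[symmetric]
        unfolding L_def[symmetric]
      proof (cases "S = \<infinity>")
        case True
        then show "Linf_norm F \<le> ennreal D * S * ennreal (L powr lam)"
          using D L by (simp add: ennreal_mult_top ennreal_top_mult)
      next
        case False
        define M where "M = enn2real S"
        have S: "S = ennreal M"
          using False by (simp add: M_def less_top)
        moreover have "1 \<le> S" by (simp add: S_def)
        ultimately have M: "1 \<le> M" by simp
        define A where "A = 1 + R powr \<alpha> * g"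
        have A: "1 \<le> A" using g by (simp add: A_def)
        have lnA: "ln A \<le> L"
        proof -
          have "(1::real) \<le> (exp 1)\<^sup>2" by (simp add: one_le_power)
          then have "A \<le> (exp 1)\<^sup>2 + X"
            unfolding A_def using \<open>R powr \<alpha> * g \<le> X\<close> by (rule add_mono)
          then show ?thesis
            unfolding L_def using A by (intro ln_mono) auto
        qed
        \<comment> \<open>Proportional to the logarithm, so that \<open>A powr (2 / (\<alpha> * q))\<close> stays bounded.\<close>
        define q where "q = 2 * L"
        define N where "N = M * (q powr lam * R powr (2 / q))"
        \<comment> \<open>The second summand keeps \<open>N'\<close> positive and gives \<open>R powr \<alpha> * N' = A\<close>.\<close>
        define N' where "N' = g + R powr (- \<alpha>)"
        \<comment> \<open>The scale at which the oscillation term has size \<open>r powr \<alpha> * N' = 1\<close>.\<close>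
        define r where "r = R * A powr (- 1 / \<alpha>)"
        have q: "2 \<le> q" and qpos: "0 < q powr lam * R powr (2 / q)"
          using L R by (auto simp: q_def)
        have N: "0 < N" using M qpos by (simp add: N_def)
        have N': "0 < N'" using g R by (simp add: N'_def add_nonneg_pos)
        have r: "0 < r" using R A by (simp add: r_def)
        have "Lp_norm q F / ennreal (q powr lam * R powr (2 / q)) \<le> S"
          unfolding S_def using q by (intro max.coboundedI2 SUP_upper) auto
        then have "Lp_norm q F \<le> S * ennreal (q powr lam * R powr (2 / q))"
          by (rule ennreal_le_mult_if_divide_le[OF qpos])
        then have FN: "Lp_norm q F \<le> ennreal N"
          unfolding S using M qpos by (simp add: N_def ennreal_mult)
        then have Fq: "F \<in> Lp_space q"
          using Fm by (auto simp: Lp_space_def intro: le_less_trans)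
        have "Lp_norm p G = ennreal g"
          using G(2) by (auto simp: g_def Lp_space_def)
        then have GN: "Lp_norm p G \<le> ennreal N'"
          by (simp add: N'_def ennreal_leI)
        have "AE x in lebesgue. \<bar>F x\<bar> \<le> 2 * K\<^sup>2 * N * r powr (- 2 / q)
            + 16 * K * N' * r powr (1 - 2 / p) / (1 - 2 powr (- (1 - 2 / p)))"
          using q by (intro AE_abs_le_Lp_norm_and_gradient[OF Fq FN N _ G GN N' p r K]) auto
        moreover have "16 * K * N' * r powr (1 - 2 / p) / (1 - 2 powr (- (1 - 2 / p))) = T"
        proof -
          have "r powr \<alpha> = R powr \<alpha> * (1 / A)"
            unfolding r_def powr_mult powr_powr using A \<alpha> by (simp add: powr_minus_divide)
          moreover have "N' * R powr \<alpha> = A"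
            using R by (simp add: N'_def A_def powr_minus field_simps)
          ultimately have "N' * r powr \<alpha> = 1"
            using A by simp
          then show ?thesis
            unfolding p\<alpha> T_def by (metis mult.assoc mult.right_neutral)
        qed
        moreover have "2 * K\<^sup>2 * N * r powr (- 2 / q) \<le> 2 * K\<^sup>2 * 2 powr lam * exp (1 / \<alpha>) * (M * L powr lam)"
        proof -
          have "r powr (- 2 / q) = R powr (- (2 / q)) * A powr (2 / (\<alpha> * q))"
            unfolding r_def powr_mult powr_powr by simp
          then have "N * r powr (- 2 / q) = M * q powr lam * A powr (2 / (\<alpha> * q))"
            using R by (simp add: N_def powr_minus)
          moreover have "A powr (2 / (\<alpha> * q)) \<le> exp (1 / \<alpha>)"
          proof -
            have "2 / (\<alpha> * q) * ln A \<le> 2 / (\<alpha> * q) * L"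
              using \<alpha> q lnA by (intro mult_left_mono) auto
            also have "\<dots> = 1 / \<alpha>"
              using L \<alpha> by (simp add: q_def)
            finally show ?thesis
              using A by (simp add: powr_def)
          qed
          then have "M * q powr lam * A powr (2 / (\<alpha> * q)) \<le> M * q powr lam * exp (1 / \<alpha>)"
            using M by (intro mult_left_mono) auto
          moreover have "q powr lam = 2 powr lam * L powr lam"
            using L by (simp add: q_def powr_mult)
          ultimately have "N * r powr (- 2 / q) \<le> 2 powr lam * exp (1 / \<alpha>) * (M * L powr lam)"
            by (simp add: mult_ac)
          from mult_left_mono[OF this, of "2 * K\<^sup>2"] show ?thesis
            by (simp add: mult_ac)
        qed
        moreover have "T \<le> T * (M * L powr lam)"
        proof -
          have "1 \<le> L powr lam" using L lam by (intro ge_one_powr_ge_zero) auto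
          then have "1 * 1 \<le> M * L powr lam" using M by (intro mult_mono) auto
          then show ?thesis using mult_left_mono[OF _ T] by fastforce
        qed
        ultimately have "AE x in lebesgue. \<bar>F x\<bar> \<le> D * (M * L powr lam)"
          unfolding D_def distrib_right by (auto elim!: eventually_mono)
        then have "Linf_norm F \<le> ennreal (D * (M * L powr lam))"
          unfolding Linf_norm_def using Fm
          by (intro esssup_I) (auto elim!: eventually_mono intro: ennreal_leI)
        also have "\<dots> = ennreal D * S * ennreal (L powr lam)"
          unfolding S using D M by (simp add: ennreal_mult mult.assoc)
        finally show "Linf_norm F \<le> ennreal D * S * ennreal (L powr lam)" .
      qed
    qed
  qed simp
qed

end
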